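(* Let $\boldsymbol v\in\mathbb R_+^M$ and $\boldsymbol W\in\mathbb R_+^{M\times R}$. For all non-negative $\tilde{\boldsymbol h},\boldsymbol h$ (vectors in $\mathbb R_+^R$), $$UB_{MU}(\boldsymbol h,\tilde{\boldsymbol h})\le UB_{Burg}(\boldsymbol h,\tilde{\boldsymbol h}).$$
   Context: $\mathbb R_+$ denotes the nonnegative reals. The Kullback-Leibler divergence between $\boldsymbol v\in\mathbb R_+^M$ and $\boldsymbol W\boldsymbol h$, with $\boldsymbol W\in\mathbb R_+^{M\times R}$ and $\boldsymbol h\in\mathbb R_+^R$, is $$D_{\mathrm{KL}}(\boldsymbol v\Vert\boldsymbol W\boldsymbol h)=\sum_{i=1}^M\Big(v_i\log v_i-v_i+(\boldsymbol W\boldsymbol h)_i-v_i\log (\boldsymbol W\boldsymbol h)_i\Big),$$ with the conventions $0\log 0=0$ and $a\log 0=-\infty$ for $a>0$. The multiplicative-updates (MU) upper bound of this loss at a current iterate $\tilde{\boldsymbol h}$ is $$UB_{MU}(\boldsymbol h,\tilde{\boldsymbol h})=\sum_{i=1}^M\Big(v_i\log v_i-v_i+(\boldsymbol W\boldsymbol h)_i-v_i\sum_{r=1}^R\alpha_{i,r}\log\frac{W_{i,r}h_r}{\alpha_{i,r}}\Big),\qquad \alpha_{i,r}=\frac{W_{i,r}\tilde h_r}{(\boldsymbol W\tilde{\boldsymbol h})_i}.$$ The Burg upper bound is $$UB_{Burg}(\boldsymbol h,\tilde{\boldsymbol h})=D_{\mathrm{KL}}(\boldsymbol v\Vert\boldsymbol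 W\tilde{\boldsymbol h})+\langle\nabla_{\boldsymbol h}D_{\mathrm{KL}}(\boldsymbol v\Vert\boldsymbol W\tilde{\boldsymbol h}),\boldsymbol h-\tilde{\boldsymbol h}\rangle+\|\boldsymbol v\|_1\,\mathcal B_\kappa(\boldsymbol h,\tilde{\boldsymbol h}),$$ where $\nabla_{\boldsymbol h}D_{\mathrm{KL}}(\boldsymbol v\Vert\boldsymbol W\tilde{\boldsymbol h})=\boldsymbol W^T\big(\mathbf 1-\tfrac{\boldsymbol v}{\boldsymbol W\tilde{\boldsymbol h}}\big)$ (entrywise division, $\mathbf 1$ the all-ones vector) is the gradient of $\boldsymbol h\mapsto D_{\mathrm{KL}}(\boldsymbol v\Vert\boldsymbol W\boldsymbol h)$ at $\tilde{\boldsymbol h}$, $\kappa(\boldsymbol h)=-\sum_{r=1}^R\log h_r$ is Burg's entropy, and $\mathcal B_\kappa(\boldsymbol x,\boldsymbol y)=\kappa(\boldsymbol x)-\kappa(\boldsymbol y)-\langle\nabla\kappa(\boldsymbol y),\boldsymbol x-\boldsymbol y\rangle=\sum_{r=1}^R\big(\tfrac{x_r}{y_r}-\log\tfrac{x_r}{y_r}-1\big)$ is the Bregman divergence associated with $\kappa$. *)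

theory Defs
  imports "HOL-Analysis.Analysis"
begin

text \<open>
  Losses take values in \<^typ>\<open>ereal\<close>, so that every expression is meaningful on the whole
  nonnegative orthant. In \<^typ>\<open>ereal\<close> the product of \<open>0\<close> and an infinite value is \<open>0\<close>;
  together with \<open>elog 0 = -\<infinity>\<close> this yields the conventions \<open>0 log 0 = 0\<close> and
  \<open>a log 0 = -\<infinity>\<close> for \<open>a > 0\<close>.
\<close>

definition elog :: "real \<Rightarrow> ereal" where
  "elog x = (if x = 0 then -\<infinity> else ereal (ln x))"

definition kl_div :: "real ^ 'm \<Rightarrow> real ^ 'm \<Rightarrow> ereal" where
  "kl_div v u = (\<Sum>i\<in>UNIV. ereal (v $ i) * elog (v $ i) - ereal (v $ i) + ereal (u $ i)
                   - ereal (v $ i) * elog (u $ i))"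

text \<open>
  If \<open>(W *v ht) $ i = 0\<close> then \<open>mu_weight W ht i r = 0\<close>, by division by zero. In \<open>UB_MU\<close> a
  vanishing weight makes the corresponding summand zero (\<open>0 log (0/0) = 0\<close>).
\<close>

definition mu_weight :: "real ^ 'r ^ 'm \<Rightarrow> real ^ 'r \<Rightarrow> 'm \<Rightarrow> 'r \<Rightarrow> real" where
  "mu_weight W ht i r = W $ i $ r * ht $ r / (W *v ht) $ i"

definition UB_MU :: "real ^ 'm \<Rightarrow> real ^ 'r ^ 'm \<Rightarrow> real ^ 'r \<Rightarrow> real ^ 'r \<Rightarrow> ereal" where
  "UB_MU v W h ht =
     (\<Sum>i\<in>UNIV. ereal (v $ i) * elog (v $ i) - ereal (v $ i) + ereal ((W *v h) $ i)
        - ereal (v $ i) * (\<Sum>r\<in>UNIV. ereal (mu_weight W ht i r)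
                                  * elog (W $ i $ r * h $ r / mu_weight W ht i r)))"

text \<open>
  Division by zero is harmless here: for \<open>(W *v ht) $ i = 0\<close> and \<open>v $ i = 0\<close> the entry
  \<open>1 - 0/0 = 1\<close> is the correct derivative, and for \<open>(W *v ht) $ i = 0\<close> and \<open>v $ i > 0\<close> the
  first summand of \<open>UB_Burg\<close> is \<open>kl_div v (W *v ht) = \<infinity>\<close>, whatever finite value
  the gradient has.
\<close>

definition kl_grad :: "real ^ 'm \<Rightarrow> real ^ 'r ^ 'm \<Rightarrow> real ^ 'r \<Rightarrow> real ^ 'r" where
  "kl_grad v W ht = transpose W *v (\<chi> i. 1 - v $ i / (W *v ht) $ i)"

definition burg_entropy :: "real ^ 'r \<Rightarrow> real" where
  "burg_entropy h = - (\<Sum>r\<in>UNIV. ln (h $ r))"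

definition burg_grad :: "real ^ 'r \<Rightarrow> real ^ 'r" where
  "burg_grad h = (\<chi> r. - 1 / h $ r)"

text \<open>
  The domain of Burg's entropy is the open positive orthant; as usual for Bregman divergences
  the value is \<open>\<infinity>\<close> as soon as one of the arguments lies outside that domain.
\<close>

definition burg_bregman :: "real ^ 'r \<Rightarrow> real ^ 'r \<Rightarrow> ereal" where
  "burg_bregman x y =
     (if (\<forall>r. 0 < x $ r) \<and> (\<forall>r. 0 < y $ r)
      then ereal (burg_entropy x - burg_entropy y - inner (burg_grad y) (x - y))
      else \<infinity>)"

text \<open>
  No summand below is \<open>-\<infinity>\<close> on nonnegative data. For \<open>v = 0\<close> the last summand is \<open>0\<close>, also
  on the boundary of the orthant.
\<close>

definition UB_Burg :: "real ^ 'm \<Rightarrow> real ^ 'r ^ 'm \<Rightarrow> real ^ 'r \<Rightarrow> real ^ 'r \<Rightarrow> ereal" where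
  "UB_Burg v W h ht =
     kl_div v (W *v ht) + ereal (inner (kl_grad v W ht) (h - ht))
       + ereal (\<Sum>i\<in>UNIV. \<bar>v $ i\<bar>) * burg_bregman h ht"

lemma burg_entropy_GDERIV:
  fixes y :: "real ^ 'r"
  assumes "\<And>r. 0 < y $ r"
  shows "GDERIV burg_entropy y :> burg_grad y"
proof -
  have "((\<lambda>h. ln (h $ r)) has_derivative (\<lambda>d. d $ r * inverse (y $ r))) (at y)" for r
    by (intro has_derivative_ln assms bounded_linear_imp_has_derivative bounded_linear_vec_nth)
  then have "(burg_entropy has_derivative (\<lambda>d. - (\<Sum>r\<in>UNIV. d $ r * inverse (y $ r)))) (at y)"
    unfolding burg_entropy_def by (intro has_derivative_minus has_derivative_sum)
  then show ?thesis
    by (simp add: gderiv_def burg_grad_def inner_vec_def sum_negf divide_inverse)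
qed

lemma burg_bregman_eq:
  fixes x y :: "real ^ 'r"
  assumes "\<And>r. 0 < x $ r" "\<And>r. 0 < y $ r"
  shows "burg_bregman x y = ereal (\<Sum>r\<in>UNIV. x $ r / y $ r - ln (x $ r / y $ r) - 1)"
proof -
  have "burg_entropy x - burg_entropy y - inner (burg_grad y) (x - y)
      = (\<Sum>r\<in>UNIV. - ln (x $ r) + ln (y $ r) + (x $ r - y $ r) / y $ r)"
    by (simp add: burg_entropy_def burg_grad_def inner_vec_def sum.distrib sum_negf
        sum_subtractf)
  also have "\<dots> = (\<Sum>r\<in>UNIV. x $ r / y $ r - ln (x $ r / y $ r) - 1)"
    using assms by (intro sum.cong refl) (simp add: ln_div diff_divide_distrib less_imp_neq[symmetric])
  finally show ?thesis
    using assms by (simp add: burg_bregman_def)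
qed

lemma kl_div_eq:
  fixes v u :: "real ^ 'm"
  assumes "\<And>i. 0 < u $ i"
  shows "kl_div v u
       = ereal (\<Sum>i\<in>UNIV. v $ i * ln (v $ i) - v $ i + u $ i - v $ i * ln (u $ i))"
proof -
  have "ereal (v $ i) * elog (v $ i) - ereal (v $ i) + ereal (u $ i) - ereal (v $ i) * elog (u $ i)
     = ereal (v $ i * ln (v $ i) - v $ i + u $ i - v $ i * ln (u $ i))" for i
    using assms[of i] by (auto simp: elog_def zero_ereal_def[symmetric])
  then show ?thesis
    by (simp add: kl_div_def)
qed

lemma kl_div_GDERIV:
  fixes v :: "real ^ 'm" and W :: "real ^ 'r ^ 'm" and ht :: "real ^ 'r"
  assumes pos: "\<And>i. 0 < (W *v ht) $ i"
  shows "GDERIV (\<lambda>h. real_of_ereal (kl_div v (W *v h))) ht :> kl_grad v W ht"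
proof -
  define S where "S = {h. \<forall>i. 0 < (W *v h) $ i}"
  define f where "f = (\<lambda>h. \<Sum>i\<in>UNIV. v $ i * ln (v $ i) - v $ i + (W *v h) $ i
                              - v $ i * ln ((W *v h) $ i))"
  have lin: "bounded_linear (\<lambda>h. (W *v h) $ i)" for i
    by (intro bounded_linear_compose[OF bounded_linear_vec_nth] matrix_vector_mul_bounded_linear)
  have "S = (\<Inter>i. {h. 0 < (W *v h) $ i})"
    by (auto simp: S_def)
  then have "open S"
    using lin by (simp add: open_INT open_Collect_less linear_continuous_on)
  have deriv: "(f has_derivative (\<lambda>d. \<Sum>i\<in>UNIV. (W *v d) $ i
                  - v $ i * ((W *v d) $ i / (W *v ht) $ i))) (at ht)"
    unfolding f_def
    by (rule derivative_eq_intros refl bounded_linear.has_derivative[OF lin] | simp add: pos)+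
       (auto simp: fun_eq_iff field_simps)
  have "inner d (kl_grad v W ht)
      = (\<Sum>i\<in>UNIV. (W *v d) $ i - v $ i * ((W *v d) $ i / (W *v ht) $ i))" for d
  proof -
    have "inner d (kl_grad v W ht)
        = (\<Sum>r\<in>UNIV. \<Sum>i\<in>UNIV. W $ i $ r * d $ r * (1 - v $ i / (W *v ht) $ i))"
      unfolding kl_grad_def inner_vec_def matrix_vector_mult_def[of "transpose W"]
      by (simp add: transpose_def sum_distrib_left mult_ac)
    also have "\<dots> = (\<Sum>i\<in>UNIV. \<Sum>r\<in>UNIV. W $ i $ r * d $ r * (1 - v $ i / (W *v ht) $ i))"
      by (rule sum.swap)
    also have "\<dots> = (\<Sum>i\<in>UNIV. (W *v d) $ i * (1 - v $ i / (W *v ht) $ i))"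
      unfolding sum_distrib_right[symmetric] by (simp add: matrix_vector_mult_def)
    finally show ?thesis
      by (simp add: right_diff_distrib mult_ac)
  qed
  then have *: "(f has_derivative (\<lambda>d. inner d (kl_grad v W ht))) (at ht)"
    using deriv by simp
  have "f h = real_of_ereal (kl_div v (W *v h))" if "h \<in> S" for h
    using that by (simp add: S_def f_def kl_div_eq)
  moreover have "ht \<in> S"
    using pos by (simp add: S_def)
  ultimately show ?thesis
    unfolding gderiv_def
    by (intro has_derivative_transform_within_open[OF * \<open>open S\<close>])
qed

end

theory Submission
  imports Defs
begin

text \<open>
  Write \<open>x\<^sub>r = h\<^sub>r / ht\<^sub>r\<close>. The claim holds row by row: since the weights \<open>\<alpha>\<^sub>i\<^sub>r\<close> of row \<open>i\<close> sum to \<open>1\<close>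
  and \<open>(W h)\<^sub>i / (W ht)\<^sub>i = \<Sum>\<^sub>r \<alpha>\<^sub>i\<^sub>r x\<^sub>r\<close>, the \<open>i\<close>-th summand of the Burg bound exceeds that of the MU
  bound by \<open>v\<^sub>i \<Sum>\<^sub>r (1 - \<alpha>\<^sub>i\<^sub>r) (x\<^sub>r - 1 - log x\<^sub>r)\<close>, and every factor is nonnegative.
  Outside the domain of Burg's entropy the Burg bound is \<open>\<infinity>\<close>, unless \<open>v = 0\<close>, where the two
  bounds coincide.
\<close>

text \<open>Moving \<open>transpose W\<close> across the inner product turns the linear term of the
  Burg bound into a sum over rows, ready for a row by row comparison.\<close>

lemma inner_kl_grad:
  fixes v :: "real ^ 'm" and W :: "real ^ 'r ^ 'm"
  shows "inner (kl_grad v W ht) d = (\<Sum>i\<in>UNIV. (1 - v $ i / (W *v ht) $ i) * (W *v d) $ i)"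
  using dot_lmul_matrix[of "\<chi> i. 1 - v $ i / (W *v ht) $ i" W d]
  by (simp add: kl_grad_def inner_vec_def)

text \<open>Since the weights sum to 1, the left side is the \<open>a\<close>-weighted sum of the
  terms \<open>x r - ln (x r) - 1\<close>. These are nonnegative, so raising every weight to 1 can
  only increase the sum.\<close>

lemma weighted_log_sum_le:
  fixes a x :: "'r::finite \<Rightarrow> real"
  assumes a: "\<And>r. 0 \<le> a r" "(\<Sum>r\<in>UNIV. a r) = 1" and x: "\<And>r. 0 < x r"
  shows "(\<Sum>r\<in>UNIV. a r * x r) - 1 - (\<Sum>r\<in>UNIV. a r * ln (x r)) \<le> (\<Sum>r\<in>UNIV. x r - ln (x r) - 1)"
proof -
  have "a r \<le> 1" for r
    using member_le_sum[of r UNIV a] a by simp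
  then have "a r * (x r - ln (x r) - 1) \<le> 1 * (x r - ln (x r) - 1)" for r
    using ln_le_minus_one[OF x[of r]] by (intro mult_right_mono) auto
  then have "(\<Sum>r\<in>UNIV. a r * (x r - ln (x r) - 1)) \<le> (\<Sum>r\<in>UNIV. x r - ln (x r) - 1)"
    by (intro sum_mono) simp
  then show ?thesis
    using a(2) by (simp add: right_diff_distrib sum_subtractf)
qed

text \<open>Dividing by a nonzero weight cancels \<open>W $ i $ r\<close> and leaves
  \<open>(W *v ht) $ i\<close> times \<open>h $ r / ht $ r\<close>. The logarithm of the first
  factor does not depend on \<open>r\<close> and comes out because the weights sum to 1.\<close>

lemma mu_weight_log_sum:
  fixes W :: "real ^ 'r ^ 'm"
  assumes W: "\<And>r. 0 \<le> W $ i $ r" and u: "0 < (W *v ht) $ i"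
    and ht: "\<And>r. 0 < ht $ r" and h: "\<And>r. 0 < h $ r"
  shows "(\<Sum>r\<in>UNIV. ereal (mu_weight W ht i r) * elog (W $ i $ r * h $ r / mu_weight W ht i r))
       = ereal (ln ((W *v ht) $ i) + (\<Sum>r\<in>UNIV. mu_weight W ht i r * ln (h $ r / ht $ r)))"
    and "(\<Sum>r\<in>UNIV. mu_weight W ht i r) = 1"
    and "(\<Sum>r\<in>UNIV. mu_weight W ht i r * (h $ r / ht $ r)) = (W *v h) $ i / (W *v ht) $ i"
proof -
  let ?u = "(W *v ht) $ i" and ?a = "mu_weight W ht i"
  show sum1: "(\<Sum>r\<in>UNIV. ?a r) = 1"
    using u by (simp add: mu_weight_def matrix_vector_mult_def flip: sum_divide_distrib)
  have "?a r * (h $ r / ht $ r) = W $ i $ r * h $ r / ?u" for r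
    using ht[of r] by (simp add: mu_weight_def)
  then have "(\<Sum>r\<in>UNIV. ?a r * (h $ r / ht $ r)) = (\<Sum>r\<in>UNIV. W $ i $ r * h $ r / ?u)"
    by simp
  also have "\<dots> = (W *v h) $ i / ?u"
    unfolding sum_divide_distrib[symmetric] by (simp add: matrix_vector_mult_def)
  finally show "(\<Sum>r\<in>UNIV. ?a r * (h $ r / ht $ r)) = (W *v h) $ i / ?u" .
  have "ereal (?a r) * elog (W $ i $ r * h $ r / ?a r)
      = ereal (?a r * (ln ?u + ln (h $ r / ht $ r)))" for r
  proof (cases "W $ i $ r = 0")
    \<comment> \<open>Here the weight is 0 and the logarithm is \<open>elog (0 / 0)\<close>, that is
      -\<infinity>; the product is still 0.\<close>
    case True
    then show ?thesis by (simp add: mu_weight_def flip: zero_ereal_def)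
  next
    case False
    then have "W $ i $ r * h $ r / ?a r = ?u * (h $ r / ht $ r)"
      using u ht[of r] by (simp add: mu_weight_def)
    moreover have "ln (?u * (h $ r / ht $ r)) = ln ?u + ln (h $ r / ht $ r)"
      using u ht[of r] h[of r] by (intro ln_mult_pos) auto
    moreover have "?u * (h $ r / ht $ r) \<noteq> 0"
      using u ht[of r] h[of r] by simp
    ultimately show ?thesis
      by (simp only: elog_def if_False times_ereal.simps)
  qed
  then have "(\<Sum>r\<in>UNIV. ereal (?a r) * elog (W $ i $ r * h $ r / ?a r))
      = ereal (\<Sum>r\<in>UNIV. ?a r * (ln ?u + ln (h $ r / ht $ r)))"
    by simp
  also have "(\<Sum>r\<in>UNIV. ?a r * (ln ?u + ln (h $ r / ht $ r)))
      = ln ?u + (\<Sum>r\<in>UNIV. ?a r * ln (h $ r / ht $ r))"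
    using sum1 by (simp add: distrib_left sum.distrib flip: sum_distrib_right)
  finally show "(\<Sum>r\<in>UNIV. ereal (?a r) * elog (W $ i $ r * h $ r / ?a r))
      = ereal (ln ?u + (\<Sum>r\<in>UNIV. ?a r * ln (h $ r / ht $ r)))" .
qed

text \<open>The last term on the right is this row's share of the Bregman term, whose factor is the
  sum of the entries of \<open>v\<close>.\<close>

lemma UB_MU_summand_le:
  fixes v :: "real ^ 'm" and W :: "real ^ 'r ^ 'm"
  assumes v: "0 \<le> v $ i" and W: "\<And>r. 0 \<le> W $ i $ r"
    and ht: "\<And>r. 0 < ht $ r" and h: "\<And>r. 0 < h $ r"
  shows "ereal (v $ i) * elog (v $ i) - ereal (v $ i) + ereal ((W *v h) $ i)
        - ereal (v $ i) * (\<Sum>r\<in>UNIV. ereal (mu_weight W ht i r)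
                                  * elog (W $ i $ r * h $ r / mu_weight W ht i r))
    \<le> ereal (v $ i) * elog (v $ i) - ereal (v $ i) + ereal ((W *v ht) $ i)
        - ereal (v $ i) * elog ((W *v ht) $ i)
        + ereal ((1 - v $ i / (W *v ht) $ i) * (W *v (h - ht)) $ i)
        + ereal (v $ i * (\<Sum>r\<in>UNIV. h $ r / ht $ r - ln (h $ r / ht $ r) - 1))"
    (is "?mu \<le> ?burg")
proof -
  let ?u = "(W *v ht) $ i" and ?a = "mu_weight W ht i"
  have diff: "(W *v (h - ht)) $ i = (W *v h) $ i - ?u"
    by (simp add: matrix_vector_mult_diff_distrib)
  have "0 \<le> ?u"
    using W ht by (auto simp: matrix_vector_mult_def less_imp_le intro!: sum_nonneg)
  then consider "v $ i = 0" | "v $ i > 0" "?u = 0" | "v $ i > 0" "?u > 0"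
    using v by linarith
  then show ?thesis
  proof cases
    case 1
    then show ?thesis
      by (simp add: diff flip: zero_ereal_def)
  next
    case 2
    \<comment> \<open>The term \<open>- v $ i * elog 0\<close> is \<infinity> and all others are
      finite.\<close>
    then have "?burg = \<infinity>"
      by (simp add: elog_def)
    then show ?thesis
      by simp
  next
    case 3
    note mu = mu_weight_log_sum[of W i ht h, OF W 3(2) ht h]
    have "0 \<le> ?a r" for r
      using 3(2) W[of r] ht[of r] by (simp add: mu_weight_def)
    then have "(W *v h) $ i / ?u - 1 - (\<Sum>r\<in>UNIV. ?a r * ln (h $ r / ht $ r))
        \<le> (\<Sum>r\<in>UNIV. h $ r / ht $ r - ln (h $ r / ht $ r) - 1)"
      using weighted_log_sum_le[of ?a "\<lambda>r. h $ r / ht $ r"] mu(2,3) ht h by simp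
    \<comment> \<open>The linear part \<open>?u + (1 - v $ i / ?u) * ((W *v h) $ i - ?u)\<close>
      equals \<open>(W *v h) $ i - v $ i * ((W *v h) $ i / ?u - 1)\<close>, so the goal is the
      previous inequality times \<open>v $ i\<close>.\<close>
    from mult_left_mono[OF this v] 3(2)
    have "(W *v h) $ i - v $ i * (ln ?u + (\<Sum>r\<in>UNIV. ?a r * ln (h $ r / ht $ r)))
      \<le> ?u - v $ i * ln ?u + (1 - v $ i / ?u) * ((W *v h) $ i - ?u)
        + v $ i * (\<Sum>r\<in>UNIV. h $ r / ht $ r - ln (h $ r / ht $ r) - 1)"
      by (simp add: algebra_simps)
    then show ?thesis
      using 3 unfolding mu(1) diff by (simp add: elog_def)
  qed
qed

text \<open>As \<open>elog\<close> is never \<infinity> and \<open>v\<close> is nonnegative, no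
  subtracted term is \<infinity>; the value -\<infinity> of \<open>elog (v $ i)\<close> occurs only
  with the factor 0.\<close>

lemma kl_div_not_MInfty:
  fixes v u :: "real ^ 'm"
  assumes "\<forall>i. 0 \<le> v $ i"
  shows "kl_div v u \<noteq> -\<infinity>"
proof -
  define f where "f i = ereal (v $ i) * elog (v $ i) - ereal (v $ i) + ereal (u $ i)
                   - ereal (v $ i) * elog (u $ i)" for i
  have "f i \<noteq> -\<infinity>" for i
    using assms[rule_format, of i] by (auto simp: f_def elog_def simp flip: zero_ereal_def)
  then have "sum f I \<noteq> -\<infinity>" for I
    by (induction I rule: infinite_finite_induct) auto
  then show ?thesis
    by (simp add: kl_div_def f_def)
qed

theorem proposition3p1:
  fixes v :: "real ^ 'm" and W :: "real ^ 'r ^ 'm" and h ht :: "real ^ 'r"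
  assumes "\<forall>i. 0 \<le> v $ i"
    and "\<forall>i r. 0 \<le> W $ i $ r"
    and "\<forall>r. 0 \<le> ht $ r"
    and "\<forall>r. 0 \<le> h $ r"
  shows "UB_MU v W h ht \<le> UB_Burg v W h ht"
proof -
  consider "v = 0" | "\<forall>r. 0 < h $ r" "\<forall>r. 0 < ht $ r"
    | "v \<noteq> 0" "\<not> ((\<forall>r. 0 < h $ r) \<and> (\<forall>r. 0 < ht $ r))"
    by blast
  then show ?thesis
  proof cases
    \<comment> \<open>Both bounds reduce to the sum of the entries of \<open>W *v h\<close>: the
      gradient term replaces \<open>ht\<close> by \<open>h\<close>, and the factor 0 removes even an
      infinite divergence.\<close>
    case 1
    then show ?thesis
      by (simp add: UB_MU_def UB_Burg_def kl_div_def inner_kl_grad matrix_vector_mult_diff_distrib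
          sum_subtractf flip: zero_ereal_def)
  next
    case 2
    have "UB_MU v W h ht \<le> (\<Sum>i\<in>UNIV.
          ereal (v $ i) * elog (v $ i) - ereal (v $ i) + ereal ((W *v ht) $ i)
        - ereal (v $ i) * elog ((W *v ht) $ i)
        + ereal ((1 - v $ i / (W *v ht) $ i) * (W *v (h - ht)) $ i)
        + ereal (v $ i * (\<Sum>r\<in>UNIV. h $ r / ht $ r - ln (h $ r / ht $ r) - 1)))"
      unfolding UB_MU_def using assms 2 by (intro sum_mono UB_MU_summand_le) auto
    \<comment> \<open>By nonnegativity \<open>\<bar>v $ i\<bar> = v $ i\<close>, so the row shares
      add up to the full Bregman term.\<close>
    also have "\<dots> = UB_Burg v W h ht"
      using assms 2
      by (simp add: UB_Burg_def kl_div_def inner_kl_grad burg_bregman_eq sum.distrib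
          flip: sum_distrib_right)
    finally show ?thesis .
  next
    case 3
    then have "burg_bregman h ht = \<infinity>"
      unfolding burg_bregman_def by auto
    \<comment> \<open>A nonzero entry makes the factor of the infinite divergence positive, so the
      product is \<infinity> and not 0.\<close>
    moreover obtain j where "v $ j \<noteq> 0"
      using 3(1) by (auto simp: vec_eq_iff)
    then have "0 < (\<Sum>i\<in>UNIV. \<bar>v $ i\<bar>)"
      by (intro sum_pos2[of _ j]) auto
    ultimately have "UB_Burg v W h ht = \<infinity>"
      using kl_div_not_MInfty[OF assms(1), of "W *v ht"] by (simp add: UB_Burg_def)
    then show ?thesis
      by simp
  qed
qed

end
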